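(* For $K>1$, $\theta\in(-\pi/2,\pi/2]$ and $c\in\mathbb{C}$ let $H_{K,\theta,c}(z)=\left[\left(\frac{K+1}{2}\right)z+e^{2i\theta}\left(\frac{K-1}{2}\right)\overline{z}\right]^2+c$. Then: (a) For each $k\in\{2,3,4\}$ there exist parameters $K>1$, $\theta\in(-\pi/2,\pi/2]$, $c\in\mathbb{C}$ such that $H_{K,\theta,c}$ has exactly $k$ fixed points in $\mathbb{C}$; and for all such parameters $H_{K,\theta,c}$ has at most four fixed points in $\mathbb{C}$. (b) There exist parameters $K>1$, $\theta\in(-\pi/2,\pi/2]$, $c\in\mathbb{C}$ such that $H_{K,\theta,c}$ has an attracting fixed point and yet $c\notin\mathcal{M}_{K,\theta}$; that is, there is an attracting fixed point in one of uncountably many components of $BO(H_{K,\theta,c})$. (c) For every $K>1$ and $\theta\in(-\pi/2,\pi/2]$ there exist $c\in\mathbb{C}$ such that $H_{K,\theta,c}$ has a saddle fixed point. Moreover, there exist parameters $K>1$, $\theta\in(-\pi/2,\pi/2]$, $c\in\mathbb{C}$ such that $H_{K,\theta,c}$ has a saddle fixed point $z_0$, and the intersection of the connected component of $BO(H_{K,\theta,c})$ containing $z_0$ with an open neighbourhood of $z_0$ is a smooth curve.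
   Context: For a map $f:\mathbb{C}\to\mathbb{C}$, $f^n$ denotes the $n$-th iterate, and the bounded orbit set is $BO(f)=\{z\in\mathbb{C}: \exists M>0 \text{ with } |f^n(z)|\le M \text{ for all } n\in\mathbb{N}\}$. The Mandelbrot set is $\mathcal{M}_{K,\theta}=\{c\in\mathbb{C}: 0\in BO(H_{K,\theta,c})\}$. Let $\lambda_1,\lambda_2$ with $|\lambda_1|\le|\lambda_2|$ be the eigenvalues of the real $2\times2$ derivative matrix of $H_{K,\theta,c}$ at a fixed point. The fixed point is attracting if $|\lambda_2|<1$, and a saddle point if $|\lambda_1|<1<|\lambda_2|$. *)

theory Defs
  imports "HOL-Analysis.Analysis" "Jordan_Normal_Form.Char_Poly"
begin

definition H :: "real \<Rightarrow> real \<Rightarrow> complex \<Rightarrow> complex \<Rightarrow> complex" where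
  "H K \<theta> c z =
     (of_real ((K + 1) / 2) * z
        + exp (2 * \<i> * of_real \<theta>) * of_real ((K - 1) / 2) * cnj z) ^ 2 + c"

definition params :: "(real \<times> real) set" where
  "params = {(K, \<theta>). K > 1 \<and> - pi / 2 < \<theta> \<and> \<theta> \<le> pi / 2}"

definition fixed_points :: "(complex \<Rightarrow> complex) \<Rightarrow> complex set" where
  "fixed_points f = {z. f z = z}"

definition BO :: "(complex \<Rightarrow> complex) \<Rightarrow> complex set" where
  "BO f = {z. \<exists>M>0. \<forall>n. cmod ((f ^^ n) z) \<le> M}"

definition Mandelbrot :: "real \<Rightarrow> real \<Rightarrow> complex set" where
  "Mandelbrot K \<theta> = {c. 0 \<in> BO (H K \<theta> c)}"

(* The columns are the images of the basis vectors 1 and \<i> of the real plane. *)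
definition real_derivative_matrix :: "(complex \<Rightarrow> complex) \<Rightarrow> complex \<Rightarrow> real mat" where
  "real_derivative_matrix f z =
     (let D = frechet_derivative f (at z)
      in mat_of_rows_list 2 [[Re (D 1), Re (D \<i>)], [Im (D 1), Im (D \<i>)]])"

(* The two complex eigenvalues, listed with algebraic multiplicity and ordered by modulus.
   Differentiability is required because frechet_derivative is total. *)
definition derivative_eigenvalues ::
    "(complex \<Rightarrow> complex) \<Rightarrow> complex \<Rightarrow> complex \<Rightarrow> complex \<Rightarrow> bool" where
  "derivative_eigenvalues f z \<mu>1 \<mu>2 \<longleftrightarrow>
     f differentiable (at z) \<and>
     char_poly (map_mat complex_of_real (real_derivative_matrix f z))
       = [:- \<mu>1, 1:] * [:- \<mu>2, 1:] \<and>
     cmod \<mu>1 \<le> cmod \<mu>2"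

definition attracting_fixed_point :: "(complex \<Rightarrow> complex) \<Rightarrow> complex \<Rightarrow> bool" where
  "attracting_fixed_point f z \<longleftrightarrow>
     z \<in> fixed_points f \<and>
     (\<exists>\<mu>1 \<mu>2. derivative_eigenvalues f z \<mu>1 \<mu>2 \<and> cmod \<mu>2 < 1)"

definition saddle_fixed_point :: "(complex \<Rightarrow> complex) \<Rightarrow> complex \<Rightarrow> bool" where
  "saddle_fixed_point f z \<longleftrightarrow>
     z \<in> fixed_points f \<and>
     (\<exists>\<mu>1 \<mu>2. derivative_eigenvalues f z \<mu>1 \<mu>2 \<and> cmod \<mu>1 < 1 \<and> 1 < cmod \<mu>2)"

(* An embedded open arc: the homeomorphic image of an open interval under an infinitely
   differentiable parametrisation with nowhere vanishing derivative;
   D n is the n-th derivative of the parametrisation. *)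
definition smooth_curve :: "complex set \<Rightarrow> bool" where
  "smooth_curve S \<longleftrightarrow>
     (\<exists>(a::real) b \<gamma> g D. a < b \<and>
        homeomorphism {a<..<b} S \<gamma> g \<and>
        D 0 = \<gamma> \<and>
        (\<forall>n. \<forall>t\<in>{a<..<b}. (D n has_vector_derivative D (Suc n) t) (at t)) \<and>
        (\<forall>t\<in>{a<..<b}. D (Suc 0) t \<noteq> 0))"

end

theory Submission
  imports Defs
begin

text \<open>For \<open>\<theta> = \<pi>/2\<close> the map is \<open>x + iy \<mapsto> x\<^sup>2 - K\<^sup>2y\<^sup>2 + c + 2Kxyi\<close> when \<open>c\<close> is real,
  and it preserves the real axis.

  If \<open>c > 1/4\<close>, the real axis escapes, hence so do all its iterated preimages. For \<open>1 < K < 2\<close> and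
  suitable such \<open>c\<close> there are nevertheless attracting fixed points off the axis, while the critical
  value \<open>c\<close> escapes. A bounded orbit then has an
  itinerary with respect to the two open half-planes, which is constant on components of the bounded
  orbit set. Each half-plane contains a preimage of every non-real point, so by
  compactness every itinerary is realised, and there are uncountably many components.

  If \<open>K\<close> is large and \<open>0 < c < 1/4\<close>, the attracting fixed point of \<open>x \<mapsto> x\<^sup>2 + c\<close> on the real axis is a
  saddle of the planar map, and bounded orbits stay so close to the two axes that near the saddle
  every point off the real axis is pushed away from it until it escapes.\<close>

subsection \<open>Eigenvalues of planar derivatives\<close>

lemma det_dim_two:
  fixes A :: "'a :: comm_ring_1 mat"
  assumes "A \<in> carrier_mat 2 2"
  shows "Determinant.det A = A $$ (0,0) * A $$ (1,1) - A $$ (0,1) * A $$ (1,0)"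
proof -
  have del: "mat_delete A i j \<in> carrier_mat 1 1" for i j
    using assms mat_delete_carrier[of A 2 2 i j] by simp
  have "Determinant.det A = (\<Sum>j<2. A $$ (0,j) * cofactor A 0 j)"
    using laplace_expansion_row[OF assms, of 0] by simp
  also have "\<dots> = A $$ (0,0) * cofactor A 0 0 + A $$ (0,1) * cofactor A 0 1"
    by (simp add: numeral_2_eq_2)
  also have "cofactor A 0 0 = A $$ (1,1)"
    unfolding cofactor_def det_single[OF del] using assms by (simp add: mat_delete_def)
  also have "cofactor A 0 1 = - A $$ (1,0)"
    unfolding cofactor_def det_single[OF del] using assms by (simp add: mat_delete_def)
  finally show ?thesis
    by simp
qed

text \<open>A monic quadratic is determined by the sum and product of its roots, so matching trace
  and determinant identifies the characteristic polynomial. Uniqueness of the derivative replaces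
  \<open>frechet_derivative\<close> by an explicit \<open>D\<close>.\<close>

lemma derivative_eigenvaluesI:
  assumes D: "(f has_derivative D) (at z)"
    and trace: "\<mu>1 + \<mu>2 = complex_of_real (Re (D 1) + Im (D \<i>))"
    and det: "\<mu>1 * \<mu>2 = complex_of_real (Re (D 1) * Im (D \<i>) - Re (D \<i>) * Im (D 1))"
    and "cmod \<mu>1 \<le> cmod \<mu>2"
  shows "derivative_eigenvalues f z \<mu>1 \<mu>2"
proof -
  define A where "A = map_mat complex_of_real (real_derivative_matrix f z)"
  have frechet: "frechet_derivative f (at z) = D"
    using frechet_derivative_at[OF D] by simp
  have A: "A = mat_of_rows_list 2
      [[of_real (Re (D 1)), of_real (Re (D \<i>))], [of_real (Im (D 1)), of_real (Im (D \<i>))]]"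
    unfolding A_def real_derivative_matrix_def frechet Let_def
    by (rule eq_matI) (auto simp: mat_of_rows_list_def less_Suc_eq numeral_2_eq_2)
  have carrier: "A \<in> carrier_mat 2 2"
    unfolding A mat_of_rows_list_def by (simp add: numeral_2_eq_2)
  have "char_poly A = [:- A $$ (0,0), 1:] * [:- A $$ (1,1), 1:] - [:- A $$ (0,1):] * [:- A $$ (1,0):]"
    unfolding char_poly_def using carrier
    by (subst det_dim_two) (auto simp: char_poly_matrix_def)
  also have "\<dots> = [:\<mu>1 * \<mu>2, - (\<mu>1 + \<mu>2), 1:]"
    unfolding trace det by (simp add: A mat_of_rows_list_def algebra_simps)
  also have "\<dots> = [:- \<mu>1, 1:] * [:- \<mu>2, 1:]"
    by (simp add: algebra_simps)
  finally show ?thesis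
    using assms(4) differentiableI[OF D]
    unfolding derivative_eigenvalues_def A_def by simp
qed

subsection \<open>The linear part\<close>

text \<open>The real-linear stretch by the factor \<open>K\<close> along the direction
  \<open>cis \<theta>\<close>, which leaves the perpendicular direction fixed.\<close>

definition lin :: "real \<Rightarrow> real \<Rightarrow> complex \<Rightarrow> complex" where
  "lin K \<theta> z = of_real ((K + 1) / 2) * z
     + exp (2 * \<i> * of_real \<theta>) * of_real ((K - 1) / 2) * cnj z"

lemma H_eq_lin: "H K \<theta> c z = (lin K \<theta> z)\<^sup>2 + c"
  by (simp add: H_def lin_def)

lemma has_derivative_H:
  "(H K \<theta> c has_derivative (\<lambda>h. 2 * lin K \<theta> z * lin K \<theta> h)) (at z)"
proof -
  have "bounded_linear (lin K \<theta>)"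
    unfolding lin_def
    by (intro bounded_linear_add bounded_linear_mult_right
        bounded_linear_compose[OF bounded_linear_mult_right bounded_linear_cnj])
  from bounded_linear_imp_has_derivative[OF this]
  have "((\<lambda>w. (lin K \<theta> w)\<^sup>2 + c) has_derivative (\<lambda>h. 2 * lin K \<theta> z * lin K \<theta> h)) (at z)"
    by (auto intro!: derivative_eq_intros simp: mult_ac)
  then show ?thesis
    by (simp add: H_eq_lin[abs_def])
qed

lemma continuous_on_H: "continuous_on S (H K \<theta> c)"
  by (meson has_derivative_H has_derivative_continuous continuous_at_imp_continuous_on)

lemma continuous_on_H_funpow: "continuous_on S (H K \<theta> c ^^ n)"
proof (induction n)
  case (Suc n)
  then show ?case
    using continuous_on_compose2[OF continuous_on_H[of UNIV] Suc] by (simp add: o_def)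
qed (simp add: id_def)

text \<open>Since \<open>exp (2 * \<i> * \<theta>) * cnj (cis \<theta>) = cis \<theta>\<close>, the
  rotation factors out. What remains multiplies real parts by the sum \<open>K\<close> of the two
  coefficients and imaginary parts by their difference 1.\<close>

lemma lin_rotate: "lin K \<theta> (cis \<theta> * Complex u v) = cis \<theta> * Complex (K * u) v"
proof -
  have "exp (2 * \<i> * of_real \<theta>) = cis \<theta> * cis \<theta>"
    by (simp add: cis_conv_exp exp_double power2_eq_square mult.assoc)
  moreover have "cis \<theta> * cnj (cis \<theta>) = 1"
    by (simp add: cis_cnj cis_mult)
  moreover have "lin K \<theta> (cis \<theta> * Complex u v) = cis \<theta> * (of_real ((K + 1) / 2) * Complex u v)
      + exp (2 * \<i> * of_real \<theta>) * cnj (cis \<theta>) * (of_real ((K - 1) / 2) * cnj (Complex u v))"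
    unfolding lin_def complex_cnj_mult by (simp only: mult_ac)
  ultimately have "lin K \<theta> (cis \<theta> * Complex u v)
      = cis \<theta> * (of_real ((K + 1) / 2) * Complex u v + of_real ((K - 1) / 2) * cnj (Complex u v))"
    by (simp only: mult.assoc mult_1_right distrib_left)
  also have "of_real ((K + 1) / 2) * Complex u v + of_real ((K - 1) / 2) * cnj (Complex u v)
      = Complex (K * u) v"
    by (simp add: complex_eq_iff field_simps)
  finally show ?thesis .
qed

lemma lin_pi_half: "lin K (pi / 2) z = Complex (Re z) (K * Im z)"
proof -
  have "exp (2 * \<i> * complex_of_real (pi / 2)) = -1"
    using exp_pi_i' by (simp add: mult_ac)
  then show ?thesis
    unfolding lin_def by (simp add: complex_eq_iff field_simps)
qed

lemma H_pi_half:
  "H K (pi / 2) c z = Complex ((Re z)\<^sup>2 - K\<^sup>2 * (Im z)\<^sup>2 + Re c) (2 * K * Re z * Im z + Im c)"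
  unfolding H_eq_lin lin_pi_half by (simp add: complex_eq_iff power2_eq_square algebra_simps)

lemma Re_H_pi_half: "Re (H K (pi / 2) c z) = (Re z)\<^sup>2 - K\<^sup>2 * (Im z)\<^sup>2 + Re c"
  and Im_H_pi_half: "Im (H K (pi / 2) c z) = 2 * K * Re z * Im z + Im c"
  by (simp_all add: H_pi_half)

lemma params_pi_half: "K > 1 \<Longrightarrow> (K, pi / 2) \<in> params"
  unfolding params_def using pi_gt_zero by (auto intro: less_trans[of _ 0])

subsection \<open>Counting fixed points\<close>

text \<open>In coordinates rotated by \<open>\<theta>\<close> the fixed point equation becomes a
  pair of real conics, the second without square terms. An inclusion suffices for an upper bound on
  the number of solutions.\<close>

lemma fixed_points_H_rotate:
  "fixed_points (H K \<theta> c) \<subseteq> (\<lambda>(u, v). cis \<theta> * Complex u v) `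
     {(u, v). K\<^sup>2 * u\<^sup>2 - v\<^sup>2 + Re (c * cis (- 2 * \<theta>)) = cos \<theta> * u + sin \<theta> * v \<and>
              2 * K * u * v + Im (c * cis (- 2 * \<theta>)) = cos \<theta> * v - sin \<theta> * u}"
proof
  fix z assume "z \<in> fixed_points (H K \<theta> c)"
  then have fix_z: "(lin K \<theta> z)\<^sup>2 + c = z"
    by (simp add: fixed_points_def H_eq_lin)
  obtain u v where uv: "cis (- \<theta>) * z = Complex u v"
    by (cases "cis (- \<theta>) * z")
  have unit: "cis \<theta> * cis (- \<theta>) = 1"
    by (simp add: cis_mult)
  have z: "z = cis \<theta> * Complex u v"
    unfolding uv[symmetric] mult.assoc[symmetric] unit by simp
  have sq: "cis (- 2 * \<theta>) = cis (- \<theta>) * cis (- \<theta>)"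
    by (simp add: cis_mult)
  have "(cis \<theta> * Complex (K * u) v)\<^sup>2 + c = cis \<theta> * Complex u v"
    using fix_z unfolding z lin_rotate .
  \<comment> \<open>This factor cancels the rotation inside the square and leaves only
    \<open>cis (- \<theta>)\<close> on the right-hand side.\<close>
  then have "cis (- 2 * \<theta>) * ((cis \<theta> * Complex (K * u) v)\<^sup>2 + c)
      = cis (- 2 * \<theta>) * (cis \<theta> * Complex u v)"
    by simp
  moreover have "cis (- 2 * \<theta>) * ((cis \<theta> * Complex (K * u) v)\<^sup>2 + c)
      = (cis \<theta> * cis (- \<theta>))\<^sup>2 * (Complex (K * u) v)\<^sup>2 + c * cis (- 2 * \<theta>)"
    unfolding sq by (simp add: power2_eq_square algebra_simps)
  moreover have "cis (- 2 * \<theta>) * (cis \<theta> * Complex u v)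
      = (cis \<theta> * cis (- \<theta>)) * (cis (- \<theta>) * Complex u v)"
    unfolding sq by (simp add: algebra_simps)
  ultimately have "(Complex (K * u) v)\<^sup>2 + c * cis (- 2 * \<theta>) = cis (- \<theta>) * Complex u v"
    unfolding unit by simp
  then have "Re ((Complex (K * u) v)\<^sup>2 + c * cis (- 2 * \<theta>)) = Re (cis (- \<theta>) * Complex u v)"
    "Im ((Complex (K * u) v)\<^sup>2 + c * cis (- 2 * \<theta>)) = Im (cis (- \<theta>) * Complex u v)"
    by simp_all
  then have "K\<^sup>2 * u\<^sup>2 - v\<^sup>2 + Re (c * cis (- 2 * \<theta>)) = cos \<theta> * u + sin \<theta> * v"
    "2 * K * u * v + Im (c * cis (- 2 * \<theta>)) = cos \<theta> * v - sin \<theta> * u"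
    by (simp_all add: power2_eq_square algebra_simps)
  then show "z \<in> (\<lambda>(u, v). cis \<theta> * Complex u v) `
     {(u, v). K\<^sup>2 * u\<^sup>2 - v\<^sup>2 + Re (c * cis (- 2 * \<theta>)) = cos \<theta> * u + sin \<theta> * v \<and>
              2 * K * u * v + Im (c * cis (- 2 * \<theta>)) = cos \<theta> * v - sin \<theta> * u}"
    unfolding z by (intro image_eqI[of _ _ "(u, v)"]) auto
qed

lemma card_quadratic_roots:
  fixes a b c :: real
  assumes "a \<noteq> 0"
  shows "finite {x. a * x\<^sup>2 + b * x + c = 0}" "card {x. a * x\<^sup>2 + b * x + c = 0} \<le> 2"
proof -
  have eq: "{x. a * x\<^sup>2 + b * x + c = 0} = {x. poly [:c, b, a:] x = 0}"
    by (auto simp: power2_eq_square algebra_simps)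
  have nz: "[:c, b, a:] \<noteq> 0"
    using assms by simp
  show "finite {x. a * x\<^sup>2 + b * x + c = 0}"
    unfolding eq by (rule poly_roots_finite[OF nz])
  show "card {x. a * x\<^sup>2 + b * x + c = 0} \<le> 2"
    unfolding eq using card_poly_roots_bound[OF nz] assms by simp
qed

text \<open>The second conic is linear in \<open>v\<close>; eliminating \<open>v\<close> leaves a quartic in \<open>u\<close>, unless the
  second conic degenerates into two lines, each of which meets the first conic at most twice.\<close>

lemma card_conics_intersection:
  fixes K \<alpha> \<beta> a b :: real
  assumes "K > 0"
  defines "S \<equiv> {(u, v). K\<^sup>2 * u\<^sup>2 - v\<^sup>2 + a = \<alpha> * u + \<beta> * v \<and> 2 * K * u * v + b = \<alpha> * v - \<beta> * u}"
  shows "finite S \<and> card S \<le> 4"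
\<comment> \<open>The second conic reads
  \<open>(2 * K * u - \<alpha>) * v + (\<beta> * u + b) = 0\<close>. It splits into two lines
  exactly when both brackets vanish at the same \<open>u\<close>, which is this condition.\<close>
proof (cases "\<beta> * \<alpha> + 2 * K * b = 0")
  case False
  define Q where "Q = [:- \<alpha>, 2 * K:]"
  define B where "B = [:b, \<beta>:]"
  \<comment> \<open>The first conic after substituting \<open>v = - B / Q\<close> and multiplying by
    \<open>Q^2\<close>.\<close>
  define P where "P = [:a, - \<alpha>, K\<^sup>2:] * Q * Q - B * B + Polynomial.smult \<beta> (B * Q)"
  have "coeff P 4 = 4 * K ^ 4"
    unfolding P_def Q_def B_def
    by (simp add: coeff_pCons power2_eq_square numeral_eq_Suc)
  then have P_nz: "P \<noteq> 0"
    using assms by auto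
  have deg: "degree P \<le> 4"
    unfolding P_def Q_def B_def by (simp add: degree_pCons_eq_if)
  have Q_nz: "2 * K * u - \<alpha> \<noteq> 0" if "(u, v) \<in> S" for u v
  proof
    assume "2 * K * u - \<alpha> = 0"
    then have u: "\<alpha> = 2 * K * u"
      by simp
    then have "b = - \<beta> * u"
      using that unfolding S_def by simp
    then show False
      using False u by simp
  qed
  have v: "v = - (\<beta> * u + b) / (2 * K * u - \<alpha>)" if "(u, v) \<in> S" for u v
    using Q_nz[OF that] that unfolding S_def by (simp add: field_simps)
  have root: "poly P u = 0" if uv: "(u, v) \<in> S" for u v
  proof -
    have q: "v * (2 * K * u - \<alpha>) = - (\<beta> * u + b)"
      using uv unfolding S_def by (simp add: algebra_simps)
    have p: "K\<^sup>2 * u\<^sup>2 - \<alpha> * u + a = v\<^sup>2 + \<beta> * v"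
      using uv unfolding S_def by simp
    have "poly P u = (K\<^sup>2 * u\<^sup>2 - \<alpha> * u + a) * (2 * K * u - \<alpha>)\<^sup>2 - (\<beta> * u + b)\<^sup>2
        + \<beta> * (\<beta> * u + b) * (2 * K * u - \<alpha>)"
      unfolding P_def Q_def B_def by (simp add: power2_eq_square algebra_simps)
    also have "\<dots> = (v * (2 * K * u - \<alpha>))\<^sup>2 - (\<beta> * u + b)\<^sup>2
        + \<beta> * (2 * K * u - \<alpha>) * (v * (2 * K * u - \<alpha>) + (\<beta> * u + b))"
      unfolding p by (simp add: power2_eq_square algebra_simps)
    also have "\<dots> = 0"
      unfolding q by (simp add: power2_eq_square algebra_simps)
    finally show ?thesis .
  qed
  have inj: "inj_on fst S"
    by (rule inj_onI) (metis v prod.collapse)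
  have sub: "fst ` S \<subseteq> {u. poly P u = 0}"
    using root by auto
  have fin: "finite {u. poly P u = 0}"
    by (rule poly_roots_finite[OF P_nz])
  have "finite S"
    using finite_imageD[OF finite_subset[OF sub fin] inj] .
  moreover have "card S \<le> 4"
    using card_image[OF inj] card_mono[OF fin sub] card_poly_roots_bound[OF P_nz] deg by linarith
  ultimately show ?thesis ..
next
  case True
  \<comment> \<open>The degenerate second conic is
    \<open>2 * K * (u - p) * (v - q) = 0\<close>.\<close>
  define p where "p = \<alpha> / (2 * K)"
  define q where "q = - \<beta> / (2 * K)"
  define V where "V = {v. 1 * v\<^sup>2 + \<beta> * v + (\<alpha> * p - K\<^sup>2 * p\<^sup>2 - a) = 0}"
  define U where "U = {u. K\<^sup>2 * u\<^sup>2 + (- \<alpha>) * u + (a - q\<^sup>2 - \<beta> * q) = 0}"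
  have \<alpha>: "\<alpha> = 2 * K * p" and \<beta>: "\<beta> = - 2 * K * q"
    using assms by (simp_all add: p_def q_def)
  have "2 * K * (b - 2 * K * p * q) = 0"
    using True unfolding \<alpha> \<beta> by (simp add: algebra_simps)
  then have b: "b = 2 * K * p * q"
    using assms by simp
  have "x \<in> {p} \<times> V \<union> U \<times> {q}" if "x \<in> S" for x
  proof -
    obtain u v where x: "x = (u, v)"
      by (cases x)
    have eqs: "K\<^sup>2 * u\<^sup>2 - v\<^sup>2 + a = \<alpha> * u + \<beta> * v" "2 * K * u * v + b = \<alpha> * v - \<beta> * u"
      using that unfolding x S_def by auto
    then have "2 * K * ((u - p) * (v - q)) = 0"
      unfolding \<alpha> \<beta> b by (simp add: algebra_simps)
    then have "u = p \<or> v = q"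
      using assms by simp
    then show ?thesis
      using eqs(1) unfolding x U_def V_def by (auto simp: algebra_simps)
  qed
  then have "S \<subseteq> {p} \<times> V \<union> U \<times> {q}"
    by blast
  moreover have "finite V" "card V \<le> 2"
    unfolding V_def by (rule card_quadratic_roots; simp)+
  moreover have "finite U" "card U \<le> 2"
    unfolding U_def by (rule card_quadratic_roots; use assms in simp)+
  moreover from calculation have "card ({p} \<times> V \<union> U \<times> {q}) \<le> 4"
    using card_Un_le[of "{p} \<times> V" "U \<times> {q}"] by (simp add: card_cartesian_product)
  ultimately show ?thesis
    by (meson card_mono finite.emptyI finite.insertI finite_SigmaI finite_UnI finite_subset le_trans)
qed

text \<open>Finiteness accompanies the bound because \<open>card\<close> is 0 on infinite
  sets.\<close>

lemma card_fixed_points_H: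
  assumes "K > 0"
  shows "finite (fixed_points (H K \<theta> c)) \<and> card (fixed_points (H K \<theta> c)) \<le> 4"
  using card_conics_intersection[OF assms, of "Re (c * cis (- 2 * \<theta>))" "cos \<theta>" "sin \<theta>"
      "Im (c * cis (- 2 * \<theta>))"] fixed_points_H_rotate[of K \<theta> c]
  by (meson card_image_le card_mono finite_imageI finite_subset le_trans)

text \<open>The imaginary part of the equation is \<open>4 * x * y = y\<close>, which forces
  \<open>y = 0\<close> or \<open>x = 1/4\<close>. The signs of \<open>1/4 - a\<close> and
  \<open>a - 3/16\<close> then decide how many solutions each line carries.\<close>

lemma fixed_points_H_2:
  "fixed_points (H 2 (pi / 2) (of_real a)) =
     {z. Im z = 0 \<and> (Re z - 1 / 2)\<^sup>2 = 1 / 4 - a} \<union> {z. Re z = 1 / 4 \<and> (Im z)\<^sup>2 = (a - 3 / 16) / 4}"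
proof -
  have "H 2 (pi / 2) (of_real a) z = z \<longleftrightarrow>
      (Im z = 0 \<and> (Re z - 1 / 2)\<^sup>2 = 1 / 4 - a) \<or> (Re z = 1 / 4 \<and> (Im z)\<^sup>2 = (a - 3 / 16) / 4)" for z
  proof -
    obtain x y where z: "z = Complex x y"
      by (cases z)
    have y: "4 * x * y = y \<longleftrightarrow> y = 0 \<or> x = 1 / 4"
      by auto
    show ?thesis
    proof (cases "x = 1 / 4")
      case True
      show ?thesis
        unfolding z H_pi_half True by (auto simp: power2_eq_square field_simps)
    next
      case False
      then show ?thesis
        unfolding z H_pi_half using y by (auto simp: power2_eq_square algebra_simps)
    qed
  qed
  then show ?thesis
    unfolding fixed_points_def by blast
qed

text \<open>At \<open>3/16\<close> the pair on \<open>x = 1/4\<close> collapses onto a real fixed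
  point, and at \<open>1/4\<close> the real pair merges. The value \<open>21/100\<close> lies
  strictly between and makes both square roots rational.\<close>

lemma fixed_points_H_examples:
  assumes "k \<in> {2, 3, 4 :: nat}"
  shows "\<exists>a. card (fixed_points (H 2 (pi / 2) (of_real a))) = k"
proof -
  have sq: "(x::real)\<^sup>2 = r \<longleftrightarrow> x = s \<or> x = - s" if "r = s\<^sup>2" for x r s
    using that by (simp add: power2_eq_iff)
  have "fixed_points (H 2 (pi / 2) (of_real (3 / 16))) = {Complex (3/4) 0, Complex (1/4) 0}"
    unfolding fixed_points_H_2
    by (subst sq[of _ "1/4"]) (auto simp: power2_eq_square complex_eq_iff)
  then have 2: "card (fixed_points (H 2 (pi / 2) (of_real (3 / 16)))) = 2"
    by simp
  have "fixed_points (H 2 (pi / 2) (of_real (1 / 4))) =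
      {Complex (1/2) 0, Complex (1/4) (1/8), Complex (1/4) (-1/8)}"
    unfolding fixed_points_H_2
    by (subst (2) sq[of _ "1/8"]) (auto simp: power2_eq_square complex_eq_iff)
  then have 3: "card (fixed_points (H 2 (pi / 2) (of_real (1 / 4)))) = 3"
    by simp
  have "fixed_points (H 2 (pi / 2) (of_real (21 / 100))) =
      {Complex (7/10) 0, Complex (3/10) 0, Complex (1/4) (3/40), Complex (1/4) (-3/40)}"
    unfolding fixed_points_H_2
    by (subst sq[of _ "1/5"], simp add: power2_eq_square, subst sq[of _ "3/40"])
      (auto simp: power2_eq_square complex_eq_iff)
  then have 4: "card (fixed_points (H 2 (pi / 2) (of_real (21 / 100)))) = 4"
    by simp
  show ?thesis
    using assms 2 3 4 by blast
qed

subsection \<open>Bounded orbits\<close>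

lemma BO_image_iff: "f z \<in> BO f \<longleftrightarrow> z \<in> BO f"
proof
  assume "f z \<in> BO f"
  then obtain M where M: "M > 0" "\<And>n. cmod ((f ^^ n) (f z)) \<le> M"
    unfolding BO_def by blast
  have "cmod ((f ^^ n) z) \<le> M + cmod z" for n
  proof (cases n)
    case (Suc m)
    then show ?thesis
      using M(2)[of m] by (simp add: funpow_swap1 add_increasing2)
  qed (use M in simp)
  then show "z \<in> BO f"
    unfolding BO_def using M(1) by (auto intro!: exI[of _ "M + cmod z"] add_pos_nonneg)
next
  assume "z \<in> BO f"
  then obtain M where M: "M > 0" "\<And>n. cmod ((f ^^ n) z) \<le> M"
    unfolding BO_def by blast
  then have "cmod ((f ^^ n) (f z)) \<le> M" for n
    using M(2)[of "Suc n"] by (simp add: funpow_swap1)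
  then show "f z \<in> BO f"
    unfolding BO_def using M(1) by auto
qed

lemma funpow_BO_iff: "(f ^^ n) z \<in> BO f \<longleftrightarrow> z \<in> BO f"
  by (induction n) (simp_all add: BO_image_iff)

lemma cmod_lin_pi_half_ge:
  assumes "K \<ge> 1"
  shows "cmod z \<le> cmod (lin K (pi / 2) z)"
proof -
  have "\<bar>Im z\<bar>\<^sup>2 \<le> \<bar>K * Im z\<bar>\<^sup>2"
    using assms by (intro power_mono) (auto simp: abs_mult mult_le_cancel_right1)
  then show ?thesis
    unfolding lin_pi_half cmod_def by simp
qed

lemma cmod_H_pi_half_ge:
  assumes "cmod c \<le> 1"
  shows "(cmod (lin K (pi / 2) z))\<^sup>2 - 1 \<le> cmod (H K (pi / 2) c z)"
proof -
  have "cmod ((lin K (pi / 2) z)\<^sup>2) - cmod c \<le> cmod (H K (pi / 2) c z)"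
    unfolding H_eq_lin by (metis norm_diff_ineq)
  then show ?thesis
    using assms by (simp add: norm_power)
qed

text \<open>By the lower bound \<open>|z|^2 - 1\<close> for the image, an excess \<open>e\<close>
  over 2 becomes at least \<open>1 + 4 * e\<close>. Counting with \<open>Suc n\<close> keeps the
  excess at least \<open>d\<close> from the start, so it gains at least \<open>d\<close> at each
  step.\<close>

lemma escape:
  assumes "K \<ge> 1" "cmod c \<le> 1" "cmod z = 2 + d" "d > 0"
  shows "2 + real (Suc n) * d \<le> cmod ((H K (pi / 2) c ^^ n) z)"
proof (induction n)
  case 0
  then show ?case using assms by simp
next
  case (Suc n)
  let ?w = "(H K (pi / 2) c ^^ n) z"
  have nd: "real n * d \<ge> 0"
    using assms by simp
  have "(2 + real (Suc n) * d)\<^sup>2 \<le> (cmod (lin K (pi / 2) ?w))\<^sup>2"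
    using Suc cmod_lin_pi_half_ge[OF assms(1), of ?w] assms(4) nd
    by (intro power_mono) (auto simp: algebra_simps)
  then have "(2 + real (Suc n) * d)\<^sup>2 - 1 \<le> cmod (H K (pi / 2) c ?w)"
    using cmod_H_pi_half_ge[OF assms(2), of K ?w] by linarith
  moreover have "(2 + real (Suc n) * d)\<^sup>2 = 4 + 4 * (real (Suc n) * d) + (real (Suc n) * d)\<^sup>2"
    by (simp add: power2_eq_square algebra_simps)
  moreover have "0 \<le> (real (Suc n) * d)\<^sup>2"
    by simp
  moreover have "real (Suc (Suc n)) * d \<le> 4 * (real (Suc n) * d)"
    using nd assms(4) by (simp add: algebra_simps)
  ultimately show ?case
    unfolding funpow.simps o_apply by linarith
qed

lemma cmod_BO_le:
  assumes "K \<ge> 1" "cmod c \<le> 1" "z \<in> BO (H K (pi / 2) c)"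
  shows "cmod z \<le> 2"
proof (rule ccontr)
  assume "\<not> cmod z \<le> 2"
  then have d: "cmod z - 2 > 0"
    by simp
  obtain M where M: "\<And>n. cmod ((H K (pi / 2) c ^^ n) z) \<le> M"
    using assms(3) unfolding BO_def by auto
  obtain n where "M < real n * (cmod z - 2)"
    using reals_Archimedean3[OF d] by blast
  moreover have "2 + real (Suc n) * (cmod z - 2) \<le> M"
    using escape[OF assms(1,2) _ d, of z n] M[of n] by simp
  ultimately show False
    using d by (simp add: algebra_simps)
qed

text \<open>One bound for all orbits presents the set as an intersection of closed sets, which gives
  compactness.\<close>

lemma BO_H_pi_half:
  assumes "K \<ge> 1" "cmod c \<le> 1"
  shows "BO (H K (pi / 2) c) = {z. \<forall>n. cmod ((H K (pi / 2) c ^^ n) z) \<le> 2}"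
proof safe
  fix z n assume "z \<in> BO (H K (pi / 2) c)"
  then show "cmod ((H K (pi / 2) c ^^ n) z) \<le> 2"
    by (intro cmod_BO_le[OF assms]) (simp add: funpow_BO_iff)
next
  fix z assume "\<forall>n. cmod ((H K (pi / 2) c ^^ n) z) \<le> 2"
  then show "z \<in> BO (H K (pi / 2) c)"
    unfolding BO_def by (auto intro!: exI[of _ 2])
qed

lemma compact_BO_H_pi_half:
  assumes "K \<ge> 1" "cmod c \<le> 1"
  shows "compact (BO (H K (pi / 2) c))"
  unfolding compact_eq_bounded_closed
proof
  show "bounded (BO (H K (pi / 2) c))"
    unfolding BO_H_pi_half[OF assms] bounded_iff
    by (metis (mono_tags, lifting) funpow_0 mem_Collect_eq)
  show "closed (BO (H K (pi / 2) c))"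
    unfolding BO_H_pi_half[OF assms]
    by (intro closed_Collect_all closed_Collect_le continuous_intros continuous_on_H_funpow)
qed

subsection \<open>Itineraries with respect to the real axis\<close>

text \<open>Since \<open>x^2 + a - x = (x - 1/2)^2 + (a - 1/4)\<close>, each step on the axis moves
  right by at least the positive constant \<open>a - 1/4\<close>.\<close>

lemma real_axis_escapes:
  assumes "K \<ge> 1" "1 / 4 < a" "a \<le> 1" "Im z = 0"
  shows "z \<notin> BO (H K (pi / 2) (of_real a))"
proof
  let ?f = "H K (pi / 2) (of_real a)"
  assume "z \<in> BO ?f"
  then have bound: "\<And>n. cmod ((?f ^^ n) z) \<le> 2"
    using BO_H_pi_half[of K "of_real a"] assms by auto
  have growth: "Im ((?f ^^ n) z) = 0 \<and> Re z + real n * (a - 1 / 4) \<le> Re ((?f ^^ n) z)" for n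
  proof (induction n)
    case (Suc n)
    let ?x = "Re ((?f ^^ n) z)"
    have "Re z + real (Suc n) * (a - 1 / 4) = (Re z + real n * (a - 1 / 4)) + (a - 1 / 4)"
      unfolding of_nat_Suc distrib_right by simp
    also have "\<dots> \<le> ?x + (a - 1 / 4)"
      using Suc.IH by simp
    also have "\<dots> = ?x\<^sup>2 + a - (?x - 1 / 2)\<^sup>2"
      by (simp add: power2_eq_square algebra_simps)
    also have "\<dots> \<le> ?x\<^sup>2 + a"
      by simp
    finally have "Re z + real (Suc n) * (a - 1 / 4) \<le> ?x\<^sup>2 + a" .
    then show ?case
      using Suc by (simp add: Re_H_pi_half Im_H_pi_half)
  qed (use assms in simp)
  obtain n where "2 - Re z < real n * (a - 1 / 4)"
    using reals_Archimedean3[of "a - 1 / 4"] assms by auto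
  then show False
    using growth[of n] bound[of n] complex_Re_le_cmod[of "(?f ^^ n) z"] by linarith
qed

lemma Im_funpow_BO_nonzero:
  assumes "K \<ge> 1" "1 / 4 < a" "a \<le> 1" "z \<in> BO (H K (pi / 2) (of_real a))"
  shows "Im ((H K (pi / 2) (of_real a) ^^ n) z) \<noteq> 0"
  using real_axis_escapes[OF assms(1-3)] assms(4) funpow_BO_iff by blast

text \<open>The two preimages of a point are negatives of each other, hence one of them lies in each
  half-plane.\<close>

lemma H_pi_half_preimage:
  assumes "K > 0" "Im w \<noteq> 0"
  shows "\<exists>z. H K (pi / 2) (of_real a) z = w \<and> (0 < Im z \<longleftrightarrow> P)"
proof -
  define s where "s = csqrt (w - of_real a)"
  \<comment> \<open>Dividing the imaginary part by \<open>K\<close> inverts the stretch, so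
    \<open>z\<close> and \<open>- z\<close> map to the two square roots.\<close>
  define z where "z = Complex (Re s) (Im s / K)"
  have "s\<^sup>2 = w - of_real a"
    by (simp add: s_def)
  moreover have "lin K (pi / 2) z = s" "lin K (pi / 2) (- z) = - s"
    using assms by (simp_all add: lin_pi_half z_def complex_eq_iff)
  ultimately have H: "H K (pi / 2) (of_real a) z = w" "H K (pi / 2) (of_real a) (- z) = w"
    by (simp_all add: H_eq_lin)
  have "Im z \<noteq> 0"
    using assms(2) H(1) by (auto simp: Im_H_pi_half)
  then have "(0 < Im z \<longleftrightarrow> P) \<or> (0 < Im (- z) \<longleftrightarrow> P)"
    by auto
  then show ?thesis
    using H by blast
qed

text \<open>The itinerary is built from its end: a point realising the shifted set
  \<open>{k. Suc k \<in> T}\<close> is pulled back to its preimage in the half-plane prescribed by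
  \<open>0 \<in> T\<close>. Preimages of bounded orbits are bounded.\<close>

lemma finite_itinerary:
  assumes "K \<ge> 1" "1 / 4 < a" "a \<le> 1" "BO (H K (pi / 2) (of_real a)) \<noteq> {}"
  shows "\<exists>z\<in>BO (H K (pi / 2) (of_real a)).
    \<forall>k<n. 0 < Im ((H K (pi / 2) (of_real a) ^^ k) z) \<longleftrightarrow> k \<in> T"
proof (induction n arbitrary: T)
  case 0
  then show ?case using assms by auto
next
  case (Suc n)
  let ?f = "H K (pi / 2) (of_real a)"
  obtain w where w: "w \<in> BO ?f" "\<forall>k<n. 0 < Im ((?f ^^ k) w) \<longleftrightarrow> Suc k \<in> T"
    using Suc[of "{k. Suc k \<in> T}"] by auto
  have "Im w \<noteq> 0"
    using real_axis_escapes assms w(1) by blast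
  then obtain z where z: "?f z = w" "0 < Im z \<longleftrightarrow> 0 \<in> T"
    using H_pi_half_preimage[of K w a "0 \<in> T"] assms by auto
  have "z \<in> BO ?f"
    using w(1) z(1) BO_image_iff by blast
  moreover have "0 < Im ((?f ^^ k) z) \<longleftrightarrow> k \<in> T" if "k < Suc n" for k
  proof (cases k)
    case (Suc m)
    then show ?thesis
      using w(2) z(1) that by (simp add: funpow_swap1)
  qed (use z in simp)
  ultimately show ?case by blast
qed

text \<open>A limit of points realising ever longer initial segments satisfies every sign condition
  weakly. It does so strictly because bounded orbits never meet the real axis.\<close>

lemma infinite_itinerary:
  assumes "K \<ge> 1" "1 / 4 < a" "a \<le> 1" "BO (H K (pi / 2) (of_real a)) \<noteq> {}"
  shows "\<exists>z\<in>BO (H K (pi / 2) (of_real a)).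
    \<forall>k. 0 < Im ((H K (pi / 2) (of_real a) ^^ k) z) \<longleftrightarrow> k \<in> T"
proof -
  let ?f = "H K (pi / 2) (of_real a)"
  obtain X where X: "\<And>n. X n \<in> BO ?f" "\<And>n k. k < n \<Longrightarrow> 0 < Im ((?f ^^ k) (X n)) \<longleftrightarrow> k \<in> T"
  proof -
    have "\<forall>n. \<exists>z. z \<in> BO ?f \<and> (\<forall>k<n. 0 < Im ((?f ^^ k) z) \<longleftrightarrow> k \<in> T)"
      using finite_itinerary[OF assms] by blast
    from choice[OF this] show ?thesis
      using that by blast
  qed
  have "compact (BO ?f)"
    using compact_BO_H_pi_half assms by simp
  then obtain l r where l: "l \<in> BO ?f" and r: "strict_mono r" and lim: "(X \<circ> r) \<longlonglongrightarrow> l"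
    unfolding compact_def using X(1) by metis
  have "0 < Im ((?f ^^ k) l) \<longleftrightarrow> k \<in> T" for k
  proof -
    have "isCont (?f ^^ k) l"
      using continuous_on_H_funpow[of UNIV] by (simp add: continuous_on_eq_continuous_at)
    then have conv: "(\<lambda>n. Im ((?f ^^ k) (X (r n)))) \<longlonglongrightarrow> Im ((?f ^^ k) l)"
      using lim by (intro tendsto_Im isCont_tendsto_compose[of l "?f ^^ k"]) (simp_all add: o_def)
    have sign: "0 < Im ((?f ^^ k) (X (r n))) \<longleftrightarrow> k \<in> T" if "n > k" for n
      using X(2)[of k "r n"] seq_suble[OF r, of n] that by simp
    have nz: "Im ((?f ^^ k) l) \<noteq> 0"
      using Im_funpow_BO_nonzero assms l by blast
    show ?thesis
    proof (cases "k \<in> T")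
      case True
      then have "0 \<le> Im ((?f ^^ k) l)"
        using sign by (intro LIMSEQ_le_const[OF conv] exI[of _ "Suc k"]) (auto intro: less_imp_le)
      then show ?thesis using nz True by simp
    next
      case False
      then have "Im ((?f ^^ k) l) \<le> 0"
        using sign by (intro LIMSEQ_le_const2[OF conv] exI[of _ "Suc k"]) (auto simp: not_less)
      then show ?thesis using False by simp
    qed
  qed
  then show ?thesis using l by blast
qed

lemma connected_same_sign:
  fixes g :: "complex \<Rightarrow> real"
  assumes "connected C" "continuous_on C g" "\<And>z. z \<in> C \<Longrightarrow> g z \<noteq> 0" "z \<in> C" "w \<in> C"
  shows "0 < g z \<longleftrightarrow> 0 < g w"
proof -
  have "connected (g ` C)"
    using assms by (intro connected_continuous_image)
  then have "0 \<in> g ` C" if "x \<in> C" "y \<in> C" "g x \<le> 0" "0 \<le> g y" for x y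
    using that connectedD_interval by blast
  then have "\<not> (g x \<le> 0 \<and> 0 \<le> g y)" if "x \<in> C" "y \<in> C" for x y
    using that assms(3) by force
  from this[OF assms(4,5)] this[OF assms(5,4)] show ?thesis
    by linarith
qed

text \<open>The imaginary part of each iterate is continuous and nonzero on the bounded orbit set,
  so a component has a single itinerary, whichever representative is chosen. Components thus map
  onto all sets of naturals, and Cantor's theorem applies.\<close>

lemma uncountable_components_BO:
  assumes "K \<ge> 1" "1 / 4 < a" "a \<le> 1" "BO (H K (pi / 2) (of_real a)) \<noteq> {}"
  shows "uncountable (components (BO (H K (pi / 2) (of_real a))))"
proof
  let ?f = "H K (pi / 2) (of_real a)"
  define itinerary where "itinerary C = {k. 0 < Im ((?f ^^ k) (SOME z. z \<in> C))}" for C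
  assume "countable (components (BO ?f))"
  moreover have "T \<in> itinerary ` components (BO ?f)" for T
  proof -
    obtain z where z: "z \<in> BO ?f" "\<And>k. 0 < Im ((?f ^^ k) z) \<longleftrightarrow> k \<in> T"
      using infinite_itinerary[OF assms, of T] by blast
    let ?C = "connected_component_set (BO ?f) z"
    define w where "w = (SOME w. w \<in> ?C)"
    have zC: "z \<in> ?C"
      using z(1) by simp
    then have wC: "w \<in> ?C"
      unfolding w_def by (rule someI)
    have nz: "Im ((?f ^^ k) x) \<noteq> 0" if "x \<in> ?C" for x k
      using that connected_component_subset Im_funpow_BO_nonzero assms by blast
    have "0 < Im ((?f ^^ k) w) \<longleftrightarrow> 0 < Im ((?f ^^ k) z)" for k
      using nz zC wC by (intro connected_same_sign[OF connected_connected_component])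
        (auto intro: continuous_intros continuous_on_H_funpow)
    then have "itinerary ?C = T"
      unfolding itinerary_def w_def[symmetric] using z(2) by simp
    moreover have "?C \<in> components (BO ?f)"
      using z(1) by (auto simp: components_def)
    ultimately show ?thesis by blast
  qed
  then have "itinerary ` components (BO ?f) = UNIV"
    by blast
  ultimately have "countable (UNIV :: nat set set)"
    by (metis countable_image)
  then have "range (from_nat_into (UNIV :: nat set set)) = UNIV"
    by (intro range_from_nat_into) auto
  then show False
    using Cantors_theorem[of "UNIV :: nat set"] by (metis Pow_UNIV)
qed

text \<open>For \<open>K = 3/2\<close> a non-real fixed point has \<open>2 * K * x = 1\<close>, so
  \<open>x = 1/3\<close> and \<open>c = 2/9 + 9/4 * y^2\<close>. The choice \<open>y = 2/15\<close>
  gives \<open>c\<close> just above \<open>1/4\<close>, while the determinant \<open>68/75\<close>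
  of the derivative stays below 1.\<close>

lemma attracting_not_Mandelbrot:
  defines "z0 \<equiv> Complex (1 / 3) (2 / 15)" and "c \<equiv> complex_of_real (59 / 225)"
  shows "attracting_fixed_point (H (3 / 2) (pi / 2) c) z0"
    and "c \<notin> Mandelbrot (3 / 2) (pi / 2)"
    and "uncountable (components (BO (H (3 / 2) (pi / 2) c)))"
    and "z0 \<in> BO (H (3 / 2) (pi / 2) c)"
proof -
  let ?f = "H (3 / 2) (pi / 2) c"
  have fix_z0: "?f z0 = z0"
    unfolding z0_def c_def by (simp add: H_pi_half power2_eq_square)
  \<comment> \<open>A root of \<open>t^2 - 5/3 * t + 68/75\<close>; the other eigenvalue is its
    conjugate.\<close>
  define \<mu> where "\<mu> = Complex (5 / 6) (sqrt 191 / 30)"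
  have "derivative_eigenvalues ?f z0 (cnj \<mu>) \<mu>"
    by (rule derivative_eigenvaluesI[OF has_derivative_H])
      (simp_all add: lin_pi_half z0_def \<mu>_def complex_eq_iff field_simps)
  moreover have "cmod \<mu> < 1"
    unfolding \<mu>_def cmod_def by (simp add: power_divide)
  ultimately show "attracting_fixed_point ?f z0"
    unfolding attracting_fixed_point_def fixed_points_def using fix_z0 by blast
  show "c \<notin> Mandelbrot (3 / 2) (pi / 2)"
    unfolding Mandelbrot_def c_def using real_axis_escapes[of "3 / 2" "59 / 225" 0] by simp
  have "(?f ^^ n) z0 = z0" for n
    by (induction n) (simp_all add: fix_z0)
  then show z0: "z0 \<in> BO ?f"
    unfolding BO_def by (auto intro!: exI[of _ 1] simp: z0_def cmod_def power_divide)
  show "uncountable (components (BO ?f))"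
    using uncountable_components_BO[of "3 / 2" "59 / 225"] z0 unfolding c_def by auto
qed

subsection \<open>Saddle points\<close>

lemma lin_surj:
  assumes "K > 0"
  shows "\<exists>z. lin K \<theta> z = p"
proof -
  obtain u v where uv: "cis (- \<theta>) * p = Complex u v"
    by (cases "cis (- \<theta>) * p")
  have "lin K \<theta> (cis \<theta> * Complex (u / K) v) = cis \<theta> * Complex u v"
    using assms by (simp add: lin_rotate)
  also have "\<dots> = p"
    unfolding uv[symmetric] mult.assoc[symmetric] by (simp add: cis_mult)
  finally show ?thesis ..
qed

text \<open>Where \<open>2 * lin K \<theta> z\<close> equals the real number \<open>m\<close>, the derivative is \<open>m * lin K \<theta>\<close>, with
  eigenvalues \<open>m\<close> and \<open>m * K\<close>; the value \<open>2 / (K + 1)\<close> of \<open>m\<close> separates them by 1.\<close>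

lemma exists_saddle:
  assumes "K > 1"
  shows "\<exists>c z0. saddle_fixed_point (H K \<theta> c) z0"
proof -
  define m where "m = 2 / (K + 1)"
  obtain z where z: "lin K \<theta> z = of_real (m / 2)"
    using lin_surj[of K \<theta> "of_real (m / 2)"] assms by auto
  have m: "0 < m" "m < 1" "1 < m * K"
    using assms by (auto simp: m_def field_simps)
  define C S where "C = cos (2 * \<theta>)" and "S = sin (2 * \<theta>)"
  have CS: "C * C + S * S = 1"
    unfolding C_def S_def by (metis power2_eq_square sin_cos_squared_add2)
  have "exp (2 * \<i> * of_real \<theta>) = cis (2 * \<theta>)"
    by (simp add: cis_conv_exp mult_ac)
  then have "exp (2 * \<i> * of_real \<theta>) = Complex C S"
    by (simp add: C_def S_def complex_eq_iff)
  then have lin_basis: "lin K \<theta> 1 = Complex ((K + 1) / 2 + C * ((K - 1) / 2)) (S * ((K - 1) / 2))"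
    "lin K \<theta> \<i> = Complex (S * ((K - 1) / 2)) ((K + 1) / 2 - C * ((K - 1) / 2))"
    unfolding lin_def by (simp_all add: complex_eq_iff)
  \<comment> \<open>The derivative at \<open>z\<close> does not depend on the additive constant, so
    that constant is free to make \<open>z\<close> a fixed point.\<close>
  have D: "(H K \<theta> (z - (lin K \<theta> z)\<^sup>2) has_derivative (\<lambda>h. of_real m * lin K \<theta> h)) (at z)"
    using has_derivative_H[of K \<theta> "z - (lin K \<theta> z)\<^sup>2" z] unfolding z by simp
  have "derivative_eigenvalues (H K \<theta> (z - (lin K \<theta> z)\<^sup>2)) z (of_real m) (of_real (m * K))"
  proof (rule derivative_eigenvaluesI[OF D])
    show "complex_of_real m + of_real (m * K) =
        of_real (Re (of_real m * lin K \<theta> 1) + Im (of_real m * lin K \<theta> \<i>))"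
      unfolding lin_basis of_real_add[symmetric] of_real_eq_iff by (simp add: field_simps)
    \<comment> \<open>Used with \<open>P = (K + 1) / 2\<close> and \<open>Q = (K - 1) / 2\<close>,
      for which \<open>P^2 - Q^2 = K\<close>.\<close>
    have "m * (P + C * Q) * (m * (P - C * Q)) - m * (S * Q) * (m * (S * Q))
        = m * (m * (P\<^sup>2 - (C * C + S * S) * Q\<^sup>2))" for P Q
      by (simp add: power2_eq_square algebra_simps)
    moreover have "((K + 1) / 2)\<^sup>2 - ((K - 1) / 2)\<^sup>2 = K"
      by (simp add: power2_eq_square field_simps)
    ultimately show "complex_of_real m * of_real (m * K) =
        of_real (Re (of_real m * lin K \<theta> 1) * Im (of_real m * lin K \<theta> \<i>)
          - Re (of_real m * lin K \<theta> \<i>) * Im (of_real m * lin K \<theta> 1))"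
      unfolding lin_basis of_real_mult[symmetric] of_real_eq_iff
      by (simp only: times_complex.sel complex.sel Re_complex_of_real Im_complex_of_real
          mult_zero_left diff_zero add_0_right CS mult_1_left)
    show "cmod (of_real m) \<le> cmod (of_real (m * K))"
      unfolding norm_of_real using m assms by simp
  qed
  moreover have "cmod (of_real m) < 1" "1 < cmod (of_real (m * K))"
    unfolding norm_of_real using m by simp_all
  moreover have "H K \<theta> (z - (lin K \<theta> z)\<^sup>2) z = z"
    by (simp add: H_eq_lin)
  ultimately show ?thesis
    unfolding saddle_fixed_point_def fixed_points_def by blast
qed

text \<open>To the right of \<open>Re z = 1/8\<close> a bounded orbit has small imaginary part, hence stays there,
  and then the imaginary part is multiplied by a factor of at least 8 at each step.\<close>

lemma BO_right_real:
  assumes "z \<in> BO (H 32 (pi / 2) (of_real (3 / 16)))" "1 / 8 \<le> Re z"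
  shows "Im z = 0"
proof (rule ccontr)
  assume Im_z: "Im z \<noteq> 0"
  let ?f = "H 32 (pi / 2) (of_real (3 / 16))"
  \<comment> \<open>The image again has bounded orbit and so lies in the disc of radius 2.\<close>
  have bound: "(cmod (lin 32 (pi / 2) w))\<^sup>2 \<le> 3" if "w \<in> BO ?f" for w
  proof -
    have "?f w \<in> BO ?f"
      using that by (simp add: BO_image_iff)
    then have "cmod (?f w) \<le> 2"
      by (intro cmod_BO_le) auto
    then show ?thesis
      using cmod_H_pi_half_ge[of "of_real (3 / 16)" 32 w] by simp
  qed
  have Im_bound: "\<bar>32 * Im w\<bar> \<le> 2" if "w \<in> BO ?f" for w
  proof -
    have "(Re w)\<^sup>2 + (32 * Im w)\<^sup>2 \<le> 3"
      using bound[OF that] by (simp add: lin_pi_half cmod_def)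
    then have "(32 * Im w)\<^sup>2 \<le> 4"
      using zero_le_power2[of "Re w"] by linarith
    then show ?thesis
      using power2_le_imp_le[of "\<bar>32 * Im w\<bar>" 2] by simp
  qed
  \<comment> \<open>Linear growth is weaker than the available factor 8 per step, but it already
    contradicts the bound on imaginary parts.\<close>
  have orbit: "(?f ^^ n) z \<in> BO ?f \<and> 1 / 8 \<le> Re ((?f ^^ n) z)
      \<and> (1 + real n) * \<bar>Im z\<bar> \<le> \<bar>Im ((?f ^^ n) z)\<bar>" for n
  proof (induction n)
    case 0
    then show ?case using assms by simp
  next
    case (Suc n)
    let ?w = "(?f ^^ n) z"
    have w: "?w \<in> BO ?f" "1 / 8 \<le> Re ?w" "(1 + real n) * \<bar>Im z\<bar> \<le> \<bar>Im ?w\<bar>"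
      using Suc by auto
    have fw: "?f ?w \<in> BO ?f"
      using w(1) by (simp add: BO_image_iff)
    have Im_f: "\<bar>Im (?f ?w)\<bar> = 64 * Re ?w * \<bar>Im ?w\<bar>"
      using w(2) by (simp add: Im_H_pi_half abs_mult)
    have "1 / 8 * \<bar>Im ?w\<bar> \<le> Re ?w * \<bar>Im ?w\<bar>"
      using w(2) by (rule mult_right_mono) simp
    then have grow: "8 * \<bar>Im ?w\<bar> \<le> \<bar>Im (?f ?w)\<bar>"
      unfolding Im_f by simp
    \<comment> \<open>Applying the bound to the image rather than to the point itself gains the
      factor 8. This makes the loss in the real part at most \<open>1/16\<close>, less than the
      added \<open>3/16\<close>.\<close>
    then have "\<bar>32 * Im ?w\<bar> \<le> 1 / 4"
      using Im_bound[OF fw] by (simp add: abs_mult)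
    then have "\<bar>32 * Im ?w\<bar>\<^sup>2 \<le> (1 / 4)\<^sup>2"
      by (rule power_mono) simp
    moreover have "(1 / 8)\<^sup>2 \<le> (Re ?w)\<^sup>2"
      using w(2) by (rule power_mono) simp
    ultimately have "1 / 8 \<le> Re (?f ?w)"
      by (simp add: Re_H_pi_half power_mult_distrib power_divide)
    moreover have "(1 + real (Suc n)) * \<bar>Im z\<bar> \<le> 2 * ((1 + real n) * \<bar>Im z\<bar>)"
      by (simp add: algebra_simps)
    then have "(1 + real (Suc n)) * \<bar>Im z\<bar> \<le> \<bar>Im (?f ?w)\<bar>"
      using grow w(3) by linarith
    ultimately show ?case
      using fw by simp
  qed
  obtain n where "1 < real n * \<bar>Im z\<bar>"
    using reals_Archimedean3[of "\<bar>Im z\<bar>"] Im_z by auto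
  moreover have "real n * \<bar>Im z\<bar> \<le> (1 + real n) * \<bar>Im z\<bar>"
    by (simp add: algebra_simps)
  moreover have "\<bar>Im ((?f ^^ n) z)\<bar> \<le> 1"
    using Im_bound[of "(?f ^^ n) z"] orbit[of n] by (simp add: abs_mult)
  ultimately show False
    using orbit[of n] by linarith
qed

text \<open>The map \<open>x \<mapsto> x^2 + 3/16\<close> is increasing on the segment and fixes its
  right end \<open>3/4\<close>, so the segment is mapped into itself.\<close>

lemma real_segment_BO:
  assumes "t \<in> {0..3 / 4}"
  shows "of_real t \<in> BO (H 32 (pi / 2) (of_real (3 / 16)))"
proof -
  let ?f = "H 32 (pi / 2) (of_real (3 / 16))"
  have orbit: "Im ((?f ^^ n) (of_real t)) = 0 \<and> Re ((?f ^^ n) (of_real t)) \<in> {0..3 / 4}" for n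
  proof (induction n)
    case (Suc n)
    then have "(Re ((?f ^^ n) (of_real t)))\<^sup>2 \<le> (3 / 4)\<^sup>2"
      by (intro power_mono) auto
    then show ?case
      using Suc by (simp add: Re_H_pi_half Im_H_pi_half power_divide)
  qed (use assms in auto)
  have "cmod ((?f ^^ n) (of_real t)) \<le> 1" for n
    using cmod_le[of "(?f ^^ n) (of_real t)"] orbit[of n] by auto
  then show ?thesis
    unfolding BO_def by (auto intro!: exI[of _ 1])
qed

lemma smooth_curve_real_segment:
  assumes "a < b"
  shows "smooth_curve (complex_of_real ` {a<..<b})"
proof -
  define D where "D n = (if n = 0 then complex_of_real else if n = 1 then (\<lambda>_. 1) else (\<lambda>_. 0))"
    for n :: nat
  have "homeomorphism {a<..<b} (complex_of_real ` {a<..<b}) complex_of_real Re"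
    by (auto simp: homeomorphism_def image_image intro!: continuous_intros)
  moreover have "D 0 = complex_of_real"
    by (simp add: D_def)
  moreover have "\<forall>n. \<forall>t\<in>{a<..<b}. (D n has_vector_derivative D (Suc n) t) (at t)"
    by (auto simp: D_def has_vector_derivative_def scaleR_conv_of_real intro!: derivative_eq_intros)
  moreover have "\<forall>t\<in>{a<..<b}. D (Suc 0) t \<noteq> 0"
    by (simp add: D_def)
  ultimately show ?thesis
    unfolding smooth_curve_def using assms by blast
qed

text \<open>At \<open>1/4\<close> the derivative is diagonal: it contracts by \<open>1/2\<close>
  along the real axis and expands by \<open>32 * 1/2 = 16\<close> across it.\<close>

lemma saddle_smooth_curve:
  defines "f \<equiv> H 32 (pi / 2) (of_real (3 / 16))"
  shows "saddle_fixed_point f (1 / 4)"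
    and "\<exists>U. open U \<and> 1 / 4 \<in> U \<and> smooth_curve (connected_component_set (BO f) (1 / 4) \<inter> U)"
proof -
  have "f (1 / 4) = 1 / 4"
    unfolding f_def by (simp add: H_pi_half power2_eq_square complex_eq_iff)
  moreover have "derivative_eigenvalues f (1 / 4) (of_real (1 / 2)) (of_real 16)"
    unfolding f_def
    by (rule derivative_eigenvaluesI[OF has_derivative_H])
      (simp_all add: lin_pi_half complex_eq_iff)
  moreover have "cmod (of_real (1 / 2)) < 1" "1 < cmod (of_real 16)"
    by simp_all
  ultimately show "saddle_fixed_point f (1 / 4)"
    unfolding saddle_fixed_point_def fixed_points_def by blast
  \<comment> \<open>The left edge confines bounded orbits in \<open>U\<close> to the real axis; the
    right edge keeps the real points of \<open>U\<close> within the invariant segment.\<close>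
  define U where "U = {z. 1 / 8 < Re z \<and> Re z < 1 / 2}"
  have "open U"
    unfolding U_def by (intro open_Collect_conj open_Collect_less continuous_intros)
  moreover have "1 / 4 \<in> U"
    by (simp add: U_def)
  moreover have "connected_component_set (BO f) (1 / 4) \<inter> U = of_real ` {1 / 8<..<1 / 2}"
  proof
    show "connected_component_set (BO f) (1 / 4) \<inter> U \<subseteq> of_real ` {1 / 8<..<1 / 2}"
    proof
      fix z assume z: "z \<in> connected_component_set (BO f) (1 / 4) \<inter> U"
      then have "Im z = 0"
        using connected_component_subset[of "BO f" "1 / 4"] unfolding U_def f_def
        by (intro BO_right_real) auto
      then have "z = of_real (Re z)"
        by (simp add: complex_eq_iff)
      then show "z \<in> of_real ` {1 / 8<..<1 / 2}"
        using z unfolding U_def by (metis (mono_tags) IntD2 greaterThanLessThan_iff image_eqI mem_Collect_eq)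
    qed
    have "connected (complex_of_real ` {0..3 / 4})"
      by (intro connected_continuous_image continuous_intros) auto
    moreover have "1 / 4 \<in> complex_of_real ` {0..3 / 4}"
      by (rule image_eqI[of _ _ "1 / 4"]) auto
    moreover have "complex_of_real ` {0..3 / 4} \<subseteq> BO f"
      unfolding f_def using real_segment_BO by blast
    ultimately have "complex_of_real ` {0..3 / 4} \<subseteq> connected_component_set (BO f) (1 / 4)"
      by (intro connected_component_maximal)
    moreover have "complex_of_real ` {1 / 8<..<1 / 2} \<subseteq> of_real ` {0..3 / 4}"
      by (intro image_mono) auto
    moreover have "complex_of_real ` {1 / 8<..<1 / 2} \<subseteq> U"
      by (auto simp: U_def)
    ultimately show "of_real ` {1 / 8<..<1 / 2} \<subseteq> connected_component_set (BO f) (1 / 4) \<inter> U"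
      by blast
  qed
  ultimately show "\<exists>U. open U \<and> 1 / 4 \<in> U \<and> smooth_curve (connected_component_set (BO f) (1 / 4) \<inter> U)"
    using smooth_curve_real_segment[of "1 / 8" "1 / 2"] by (intro exI[of _ U]) simp
qed

theorem theorem1p4:
  shows
    "((\<forall>k\<in>{2, 3, 4::nat}. \<exists>K \<theta> c. (K, \<theta>) \<in> params \<and>
          finite (fixed_points (H K \<theta> c)) \<and> card (fixed_points (H K \<theta> c)) = k) \<and>
      (\<forall>K \<theta> c. (K, \<theta>) \<in> params \<longrightarrow>
          finite (fixed_points (H K \<theta> c)) \<and> card (fixed_points (H K \<theta> c)) \<le> 4)) \<and>
     (\<exists>K \<theta> c z0. (K, \<theta>) \<in> params \<and>
          attracting_fixed_point (H K \<theta> c) z0 \<and>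
          c \<notin> Mandelbrot K \<theta> \<and>
          (\<exists>C \<in> components (BO (H K \<theta> c)). z0 \<in> C) \<and>
          uncountable (components (BO (H K \<theta> c)))) \<and>
     ((\<forall>K \<theta>. (K, \<theta>) \<in> params \<longrightarrow> (\<exists>c z0. saddle_fixed_point (H K \<theta> c) z0)) \<and>
      (\<exists>K \<theta> c z0. (K, \<theta>) \<in> params \<and>
          saddle_fixed_point (H K \<theta> c) z0 \<and>
          (\<exists>U. open U \<and> z0 \<in> U \<and>
            smooth_curve (connected_component_set (BO (H K \<theta> c)) z0 \<inter> U))))"
proof (intro conjI ballI allI impI)
  fix k assume "k \<in> {2, 3, 4 :: nat}"
  then obtain a where "card (fixed_points (H 2 (pi / 2) (complex_of_real a))) = k"
    using fixed_points_H_examples by blast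
  then show "\<exists>K \<theta> c. (K, \<theta>) \<in> params \<and>
      finite (fixed_points (H K \<theta> c)) \<and> card (fixed_points (H K \<theta> c)) = k"
    using card_fixed_points_H[of 2 "pi / 2" "of_real a"] params_pi_half[of 2]
    by (intro exI[of _ 2] exI[of _ "pi / 2"] exI[of _ "complex_of_real a"]) simp
next
  fix K \<theta> :: real and c :: complex assume "(K, \<theta>) \<in> params"
  then have "K > 0"
    by (simp add: params_def)
  then show "finite (fixed_points (H K \<theta> c))" "card (fixed_points (H K \<theta> c)) \<le> 4"
    using card_fixed_points_H by blast+
next
  let ?c = "complex_of_real (59 / 225)" and ?z0 = "Complex (1 / 3) (2 / 15)"
  have "\<exists>C \<in> components (BO (H (3 / 2) (pi / 2) ?c)). ?z0 \<in> C"
    using attracting_not_Mandelbrot(4) Union_components by blast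
  then show "\<exists>K \<theta> c z0. (K, \<theta>) \<in> params \<and> attracting_fixed_point (H K \<theta> c) z0 \<and>
      c \<notin> Mandelbrot K \<theta> \<and> (\<exists>C \<in> components (BO (H K \<theta> c)). z0 \<in> C) \<and>
      uncountable (components (BO (H K \<theta> c)))"
    using attracting_not_Mandelbrot(1-3) params_pi_half[of "3 / 2"]
    by (intro exI[of _ "3 / 2"] exI[of _ "pi / 2"] exI[of _ ?c] exI[of _ ?z0] conjI) simp_all
next
  fix K \<theta> :: real assume "(K, \<theta>) \<in> params"
  then show "\<exists>c z0. saddle_fixed_point (H K \<theta> c) z0"
    by (intro exists_saddle) (simp add: params_def)
next
  show "\<exists>K \<theta> c z0. (K, \<theta>) \<in> params \<and> saddle_fixed_point (H K \<theta> c) z0 \<and>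
      (\<exists>U. open U \<and> z0 \<in> U \<and> smooth_curve (connected_component_set (BO (H K \<theta> c)) z0 \<inter> U))"
    using saddle_smooth_curve params_pi_half[of 32]
    by (intro exI[of _ 32] exI[of _ "pi / 2"] exI[of _ "complex_of_real (3 / 16)"] exI[of _ "1 / 4"] conjI)
      simp_all
qed

end
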